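(* Let $\mathcal{D}=\{D_a\}_{a\in A}$ be an ideal cover or a filter cover of a finite category $C$, indexed by a totally ordered finite set $A$. If each intersection $D_{a_0\ldots a_i}=D_{a_0}\cap\cdots\cap D_{a_i}$ and $C$ have Euler characteristics, then $$\chi(C)=\sum_{i=0}^{|A|-1}\ \sum_{a_0<\cdots<a_i}(-1)^i\,\chi(D_{a_0\ldots a_i}),$$ where the inner sum runs over strictly increasing sequences of elements of $A$.
   Context: A finite category is a category with finitely many objects and morphisms. Covers. For subcategories $\{D_a\}_{a\in A}$ of a small category $C$, the union $\bigcup_{a} D_a$ is the subcategory of $C$ with object set $\bigcup_a \mathrm{ob}(D_a)$ whose morphisms are all finite compositions $f_n\cdots f_0$ of composable morphisms $f_i$ of $C$, each $f_i$ belonging to some $D_{a_i}$. The family $\{D_a\}_{a\in A}$ is a cover of $C$ if $C=\bigcup_{a\in A}D_a$. Intersections of subcategories are taken on objects and on morphisms. Ideals and filters. An ideal $D$ of $C$ is a full subcategory such that an object $y$ of $C$ belongs to $D$ whenever $C(y,x)\neq\emptyset$ for some object $x$ of $D$. A filter $D$ of $C$ is a full subcategory such that an object $y$ of $C$ belongs to $D$ whenever $C(x,y)\neq\emptyset$ for some object $x$ of $D$. A cover $\{D_a\}_{a\in A}$ is an ideal (resp. filter) cover if every $D_a$ is an ideal (resp. filter) of $C$. Euler characteristic (Leinster). For a finite category $X$, let $\zeta:\mathrm{ob}(X)\times\mathrm{ob}(X)\to\mathbb{Q}$, $\zeta(a,b)=|X(a,b)|$. A weighting on $X$ is a function $w:\mathrm{ob}(X)\to\mathbb{Q}$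 with $\sum_{b}\zeta(a,b)w(b)=1$ for every object $a$; a coweighting on $X$ is a function $v:\mathrm{ob}(X)\to\mathbb{Q}$ with $\sum_{a}v(a)\zeta(a,b)=1$ for every object $b$. The category $X$ has Euler characteristic if it has both a weighting $w$ and a coweighting $v$; then $\chi(X)=\sum_{a}w(a)=\sum_{a}v(a)\in\mathbb{Q}$, which is independent of the choices. *)

theory Defs
  imports Complex_Main
begin

section \<open>Categories and subcategories\<close>

text \<open>The operations are total functions, relevant only on \<open>Obj\<close>, \<open>Mor\<close> and composable pairs;
  \<open>Comp C g f\<close> is the composite of \<open>g\<close> after \<open>f\<close>.\<close>

record ('o, 'm) category =
  Obj :: "'o set"
  Mor :: "'m set"
  Dom :: "'m \<Rightarrow> 'o"
  Cod :: "'m \<Rightarrow> 'o"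
  Id :: "'o \<Rightarrow> 'm"
  Comp :: "'m \<Rightarrow> 'm \<Rightarrow> 'm"

definition hom :: "('o, 'm) category \<Rightarrow> 'o \<Rightarrow> 'o \<Rightarrow> 'm set" where
  "hom C x y = {f \<in> Mor C. Dom C f = x \<and> Cod C f = y}"

locale category =
  fixes C :: "('o, 'm) category"
  assumes Dom_in: "f \<in> Mor C \<Longrightarrow> Dom C f \<in> Obj C"
    and Cod_in: "f \<in> Mor C \<Longrightarrow> Cod C f \<in> Obj C"
    and Id_in: "x \<in> Obj C \<Longrightarrow> Id C x \<in> hom C x x"
    and Comp_in: "f \<in> hom C x y \<Longrightarrow> g \<in> hom C y z \<Longrightarrow> Comp C g f \<in> hom C x z"
    and Comp_Id: "f \<in> hom C x y \<Longrightarrow> Comp C f (Id C x) = f"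
    and Id_Comp: "f \<in> hom C x y \<Longrightarrow> Comp C (Id C y) f = f"
    and Comp_assoc: "f \<in> hom C w x \<Longrightarrow> g \<in> hom C x y \<Longrightarrow> h \<in> hom C y z \<Longrightarrow>
      Comp C h (Comp C g f) = Comp C (Comp C h g) f"

locale finite_category = category +
  assumes finite_Obj: "finite (Obj C)"
    and finite_Mor: "finite (Mor C)"

definition subcategory :: "('o, 'm) category \<Rightarrow> ('o, 'm) category \<Rightarrow> bool" where
  "subcategory D C \<longleftrightarrow> category D \<and> Obj D \<subseteq> Obj C \<and> Mor D \<subseteq> Mor C \<and>
    (\<forall>f\<in>Mor D. Dom D f = Dom C f \<and> Cod D f = Cod C f) \<and>
    (\<forall>x\<in>Obj D. Id D x = Id C x) \<and>
    (\<forall>f\<in>Mor D. \<forall>g\<in>Mor D. Dom D g = Cod D f \<longrightarrow> Comp D g f = Comp C g f)"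

definition full_subcategory :: "('o, 'm) category \<Rightarrow> ('o, 'm) category \<Rightarrow> bool" where
  "full_subcategory D C \<longleftrightarrow> subcategory D C \<and>
    (\<forall>x\<in>Obj D. \<forall>y\<in>Obj D. hom D x y = hom C x y)"

section \<open>Unions, intersections and covers\<close>

text \<open>All composites \<open>f\<^sub>n \<dots> f\<^sub>0\<close> (\<open>n \<ge> 0\<close>) of composable members of \<open>M\<close>.\<close>

inductive_set composites :: "('o, 'm) category \<Rightarrow> 'm set \<Rightarrow> 'm set"
  for C :: "('o, 'm) category" and M :: "'m set" where
  single: "f \<in> M \<Longrightarrow> f \<in> composites C M"
| comp: "f \<in> composites C M \<Longrightarrow> g \<in> M \<Longrightarrow> Dom C g = Cod C f \<Longrightarrow> Comp C g f \<in> composites C M"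

text \<open>Unions and intersections carry the operations of the ambient category \<open>C\<close>. Intersections are
  only meaningful for nonempty \<open>S\<close>.\<close>

definition Union_subcat ::
    "('o, 'm) category \<Rightarrow> 'i set \<Rightarrow> ('i \<Rightarrow> ('o, 'm) category) \<Rightarrow> ('o, 'm) category" where
  "Union_subcat C A D =
    C\<lparr>Obj := (\<Union>a\<in>A. Obj (D a)), Mor := composites C (\<Union>a\<in>A. Mor (D a))\<rparr>"

definition Inter_subcat ::
    "('o, 'm) category \<Rightarrow> 'i set \<Rightarrow> ('i \<Rightarrow> ('o, 'm) category) \<Rightarrow> ('o, 'm) category" where
  "Inter_subcat C S D = C\<lparr>Obj := (\<Inter>a\<in>S. Obj (D a)), Mor := (\<Inter>a\<in>S. Mor (D a))\<rparr>"

definition cover :: "('o, 'm) category \<Rightarrow> 'i set \<Rightarrow> ('i \<Rightarrow> ('o, 'm) category) \<Rightarrow> bool" where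
  "cover C A D \<longleftrightarrow> (\<forall>a\<in>A. subcategory (D a) C) \<and> C = Union_subcat C A D"

definition cat_ideal :: "('o, 'm) category \<Rightarrow> ('o, 'm) category \<Rightarrow> bool" where
  "cat_ideal D C \<longleftrightarrow> full_subcategory D C \<and>
    (\<forall>y\<in>Obj C. (\<exists>x\<in>Obj D. hom C y x \<noteq> {}) \<longrightarrow> y \<in> Obj D)"

definition cat_filter :: "('o, 'm) category \<Rightarrow> ('o, 'm) category \<Rightarrow> bool" where
  "cat_filter D C \<longleftrightarrow> full_subcategory D C \<and>
    (\<forall>y\<in>Obj C. (\<exists>x\<in>Obj D. hom C x y \<noteq> {}) \<longrightarrow> y \<in> Obj D)"

definition ideal_cover :: "('o, 'm) category \<Rightarrow> 'i set \<Rightarrow> ('i \<Rightarrow> ('o, 'm) category) \<Rightarrow> bool" where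
  "ideal_cover C A D \<longleftrightarrow> cover C A D \<and> (\<forall>a\<in>A. cat_ideal (D a) C)"

definition filter_cover :: "('o, 'm) category \<Rightarrow> 'i set \<Rightarrow> ('i \<Rightarrow> ('o, 'm) category) \<Rightarrow> bool" where
  "filter_cover C A D \<longleftrightarrow> cover C A D \<and> (\<forall>a\<in>A. cat_filter (D a) C)"

lemma subcategory_Inter_subcat:
  assumes C: "category C" and ne: "S \<noteq> {}" and sub: "\<And>a. a \<in> S \<Longrightarrow> subcategory (D a) C"
  shows "subcategory (Inter_subcat C S D) C"
proof -
  let ?I = "Inter_subcat C S D"
  have MI: "Mor ?I = (\<Inter>a\<in>S. Mor (D a))" and OI: "Obj ?I = (\<Inter>a\<in>S. Obj (D a))"
    and ops: "Dom ?I = Dom C" "Cod ?I = Cod C" "Id ?I = Id C" "Comp ?I = Comp C"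
    by (simp_all add: Inter_subcat_def)
  have cat: "category (D a)" if "a \<in> S" for a
    using sub[OF that] by (simp add: subcategory_def)
  obtain s where s: "s \<in> S" using ne by blast
  have subM: "Mor ?I \<subseteq> Mor C" and subO: "Obj ?I \<subseteq> Obj C"
    using s sub[OF s] by (auto simp: MI OI subcategory_def)
  have homI: "f \<in> hom C x y" if "f \<in> hom ?I x y" for f x y
    using that subM by (auto simp: hom_def ops)
  have homD: "f \<in> hom (D a) x y" if "f \<in> hom ?I x y" "a \<in> S" for f x y a
    using that sub[of a] by (auto simp: hom_def MI ops subcategory_def)
  have "category ?I"
  proof
    fix f assume f: "f \<in> Mor ?I"
    have "Dom C f \<in> Obj (D a) \<and> Cod C f \<in> Obj (D a)" if "a \<in> S" for a
      using f that sub[OF that] category.Dom_in[OF cat[OF that], of f]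
        category.Cod_in[OF cat[OF that], of f]
      by (auto simp: MI subcategory_def)
    then show "Dom ?I f \<in> Obj ?I" "Cod ?I f \<in> Obj ?I" by (auto simp: OI ops)
  next
    fix x assume x: "x \<in> Obj ?I"
    have "Id C x \<in> Mor (D a)" if "a \<in> S" for a
      using x that sub[OF that] category.Id_in[OF cat[OF that], of x]
      by (auto simp: OI subcategory_def hom_def)
    moreover have "Id C x \<in> hom C x x" using category.Id_in[OF C] x subO by blast
    ultimately show "Id ?I x \<in> hom ?I x x" by (auto simp: hom_def MI ops)
  next
    fix f g x y z assume f: "f \<in> hom ?I x y" and g: "g \<in> hom ?I y z"
    have "Comp C g f \<in> Mor (D a)" if "a \<in> S" for a
      using homD[OF f that] homD[OF g that] sub[OF that]
        category.Comp_in[OF cat[OF that], of f x y g z]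
      by (auto simp: subcategory_def hom_def)
    moreover have "Comp C g f \<in> hom C x z"
      using category.Comp_in[OF C homI[OF f] homI[OF g]] .
    ultimately show "Comp ?I g f \<in> hom ?I x z" by (auto simp: hom_def MI ops)
  next
    fix f x y assume f: "f \<in> hom ?I x y"
    show "Comp ?I f (Id ?I x) = f" "Comp ?I (Id ?I y) f = f"
      using category.Comp_Id[OF C homI[OF f]] category.Id_Comp[OF C homI[OF f]]
      by (simp_all add: ops)
  next
    fix f g h w x y z
    assume f: "f \<in> hom ?I w x" and g: "g \<in> hom ?I x y" and h: "h \<in> hom ?I y z"
    show "Comp ?I h (Comp ?I g f) = Comp ?I (Comp ?I h g) f"
      unfolding ops by (rule category.Comp_assoc[OF C homI[OF f] homI[OF g] homI[OF h]])
  qed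
  then show ?thesis using subM subO by (simp add: subcategory_def ops)
qed

section \<open>Euler characteristic\<close>

definition zeta :: "('o, 'm) category \<Rightarrow> 'o \<Rightarrow> 'o \<Rightarrow> rat" where
  "zeta X a b = of_nat (card (hom X a b))"

definition weighting :: "('o, 'm) category \<Rightarrow> ('o \<Rightarrow> rat) \<Rightarrow> bool" where
  "weighting X w \<longleftrightarrow> (\<forall>a\<in>Obj X. (\<Sum>b\<in>Obj X. zeta X a b * w b) = 1)"

definition coweighting :: "('o, 'm) category \<Rightarrow> ('o \<Rightarrow> rat) \<Rightarrow> bool" where
  "coweighting X v \<longleftrightarrow> (\<forall>b\<in>Obj X. (\<Sum>a\<in>Obj X. v a * zeta X a b) = 1)"

definition has_euler_char :: "('o, 'm) category \<Rightarrow> bool" where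
  "has_euler_char X \<longleftrightarrow> (\<exists>w. weighting X w) \<and> (\<exists>v. coweighting X v)"

definition euler_char :: "('o, 'm) category \<Rightarrow> rat" where
  "euler_char X = (THE q. \<exists>w v. weighting X w \<and> coweighting X v \<and>
    q = (\<Sum>a\<in>Obj X. w a) \<and> q = (\<Sum>a\<in>Obj X. v a))"

lemma sum_weighting_eq_sum_coweighting:
  assumes w: "weighting X w" and v: "coweighting X v"
  shows "(\<Sum>a\<in>Obj X. w a) = (\<Sum>a\<in>Obj X. v a)"
proof -
  have "(\<Sum>b\<in>Obj X. w b) = (\<Sum>b\<in>Obj X. (\<Sum>a\<in>Obj X. v a * zeta X a b) * w b)"
    using v by (intro sum.cong) (simp_all add: coweighting_def)
  also have "\<dots> = (\<Sum>b\<in>Obj X. \<Sum>a\<in>Obj X. v a * (zeta X a b * w b))"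
    by (simp add: sum_distrib_right mult.assoc)
  also have "\<dots> = (\<Sum>a\<in>Obj X. \<Sum>b\<in>Obj X. v a * (zeta X a b * w b))"
    by (rule sum.swap)
  also have "\<dots> = (\<Sum>a\<in>Obj X. v a * (\<Sum>b\<in>Obj X. zeta X a b * w b))"
    by (simp add: sum_distrib_left)
  also have "\<dots> = (\<Sum>a\<in>Obj X. v a)"
    using w by (intro sum.cong) (simp_all add: weighting_def)
  finally show ?thesis .
qed

lemma euler_char_eq:
  assumes "weighting X w" "coweighting X v"
  shows "euler_char X = (\<Sum>a\<in>Obj X. w a)" "euler_char X = (\<Sum>a\<in>Obj X. v a)"
proof -
  show "euler_char X = (\<Sum>a\<in>Obj X. w a)"
    unfolding euler_char_def
  proof (rule the_equality)
    show "\<exists>w' v'. weighting X w' \<and> coweighting X v' \<and>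
        (\<Sum>a\<in>Obj X. w a) = (\<Sum>a\<in>Obj X. w' a) \<and> (\<Sum>a\<in>Obj X. w a) = (\<Sum>a\<in>Obj X. v' a)"
      using assms sum_weighting_eq_sum_coweighting by blast
  next
    fix q
    assume "\<exists>w v. weighting X w \<and> coweighting X v \<and>
      q = (\<Sum>a\<in>Obj X. w a) \<and> q = (\<Sum>a\<in>Obj X. v a)"
    then show "q = (\<Sum>a\<in>Obj X. w a)"
      using assms sum_weighting_eq_sum_coweighting by metis
  qed
  then show "euler_char X = (\<Sum>a\<in>Obj X. v a)"
    using sum_weighting_eq_sum_coweighting[OF assms] by simp
qed

section \<open>Increasing sequences\<close>

text \<open>The sequences \<open>a\<^sub>0 < \<dots> < a\<^sub>i\<close> in \<open>A\<close>, of length \<open>i + 1\<close>.\<close>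

definition incr_seqs :: "'i::linorder set \<Rightarrow> nat \<Rightarrow> 'i list set" where
  "incr_seqs A i = {as. length as = Suc i \<and> sorted_wrt (<) as \<and> set as \<subseteq> A}"

lemma finite_incr_seqs: "finite A \<Longrightarrow> finite (incr_seqs A i)"
  by (rule finite_subset[OF _ finite_lists_length_eq[of A "Suc i"]]) (auto simp: incr_seqs_def)

end

theory Submission
  imports Defs
begin

text \<open>
  If \<open>I\<close> is an ideal of \<open>C\<close> and \<open>b\<close> is an object of \<open>I\<close>, then every object \<open>a\<close> with
  \<open>zeta C a b \<noteq> 0\<close> lies in \<open>I\<close> as well. So the coweighting equation of \<open>C\<close> at \<open>b\<close> involves only
  objects of \<open>I\<close> and is already the coweighting equation of \<open>I\<close> at \<open>b\<close>: a coweighting of \<open>C\<close>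
  restricts to a coweighting of every ideal (\<open>coweighting_cat_ideal\<close>). Intersections of nonempty families of
  ideals are ideals, hence a single coweighting \<open>v\<close> of \<open>C\<close> computes the Euler characteristics of \<open>C\<close>
  and of all the intersections at once, each as the total mass that the signed measure
  \<open>X \<mapsto> (\<Sum>x\<in>X. v x)\<close> gives to a set of objects. The objects of \<open>C\<close> are the union of the objects of
  the members of the cover, so the formula is inclusion-exclusion for this measure
  (\<open>sum_UN_incr_seqs\<close>).

  For filters the same argument works with weightings, since \<open>zeta C a b \<noteq> 0\<close> with \<open>a\<close> in a filter
  puts \<open>b\<close> in that filter.

  In each case the other of the two functions on an intersection comes from the hypothesis that
  the intersection has Euler characteristic; the sum of its values then agrees with the restricted
  one by \<open>sum_weighting_eq_sum_coweighting\<close>.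
\<close>

section \<open>Inclusion-exclusion over increasing sequences\<close>

lemma bij_betw_set_incr_seqs:
  assumes "finite A"
  shows "bij_betw set (incr_seqs A i) {B. B \<subseteq> A \<and> card B = Suc i}"
proof (rule bij_betw_byWitness[where f' = sorted_list_of_set])
  have fin: "finite B" if "B \<subseteq> A" for B
    using that assms by (rule finite_subset)
  show "\<forall>as\<in>incr_seqs A i. sorted_list_of_set (set as) = as"
    by (auto simp: incr_seqs_def strict_sorted_iff sorted_list_of_set.idem_if_sorted_distinct)
  show "\<forall>B\<in>{B. B \<subseteq> A \<and> card B = Suc i}. set (sorted_list_of_set B) = B"
    by (simp add: fin)
  show "set ` incr_seqs A i \<subseteq> {B. B \<subseteq> A \<and> card B = Suc i}"
    by (auto simp: incr_seqs_def strict_sorted_iff distinct_card)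
  show "sorted_list_of_set ` {B. B \<subseteq> A \<and> card B = Suc i} \<subseteq> incr_seqs A i"
    by (auto simp: incr_seqs_def fin)
qed

lemma sum_nonempty_subsets_incr_seqs:
  fixes g :: "'i::linorder set \<Rightarrow> 'b::comm_monoid_add"
  assumes A: "finite A"
  shows "(\<Sum>B | B \<subseteq> A \<and> B \<noteq> {}. g B) = (\<Sum>i<card A. \<Sum>as\<in>incr_seqs A i. g (set as))"
proof -
  let ?N = "{B. B \<subseteq> A \<and> B \<noteq> {}}"
  have pos: "card B > 0" and le: "card B \<le> card A" if "B \<subseteq> A" "B \<noteq> {}" for B
    using that A by (auto simp: card_gt_0_iff card_mono dest: finite_subset)
  have "(\<Sum>B\<in>?N. g B) = (\<Sum>i<card A. \<Sum>B | B \<in> ?N \<and> card B - 1 = i. g B)"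
  proof (rule sum.group[symmetric])
    show "(\<lambda>B. card B - 1) ` ?N \<subseteq> {..<card A}"
    proof (rule image_subsetI)
      fix B assume "B \<in> ?N"
      with pos[of B] le[of B] show "card B - 1 \<in> {..<card A}"
        by simp
    qed
  qed (use A in auto)
  also have "\<dots> = (\<Sum>i<card A. \<Sum>B | B \<subseteq> A \<and> card B = Suc i. g B)"
  proof (intro sum.cong refl)
    fix i
    have "B \<noteq> {} \<and> card B - 1 = i \<longleftrightarrow> card B = Suc i" if "B \<subseteq> A" for B
      using pos[OF that] by (cases "B = {}") auto
    then show "{B. B \<in> ?N \<and> card B - 1 = i} = {B. B \<subseteq> A \<and> card B = Suc i}"
      by blast
  qed
  also have "\<dots> = (\<Sum>i<card A. \<Sum>as\<in>incr_seqs A i. g (set as))"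
    by (intro sum.cong refl sum.reindex_bij_betw[symmetric] bij_betw_set_incr_seqs A)
  finally show ?thesis .
qed

lemma sum_UN_incr_seqs:
  fixes u :: "'a \<Rightarrow> 'b::comm_ring_1" and X :: "'i::linorder \<Rightarrow> 'a set"
  assumes A: "finite A" and X: "\<And>a. a \<in> A \<Longrightarrow> finite (X a)"
  shows "sum u (\<Union>a\<in>A. X a) =
    (\<Sum>i<card A. \<Sum>as\<in>incr_seqs A i. (-1) ^ i * sum u (\<Inter>a\<in>set as. X a))"
proof -
  interpret Incl_Excl finite "sum u"
    by unfold_locales (auto simp: sum.union_disjoint disjnt_def)
  have "sum u (\<Union>a\<in>A. X a) =
      (\<Sum>B | B \<subseteq> A \<and> B \<noteq> {}. (-1) ^ (card B + 1) * sum u (\<Inter>a\<in>B. X a))"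
    by (rule restricted_indexed[OF A X])
  also have "\<dots> = (\<Sum>i<card A. \<Sum>as\<in>incr_seqs A i.
      (-1) ^ (card (set as) + 1) * sum u (\<Inter>a\<in>set as. X a))"
    by (rule sum_nonempty_subsets_incr_seqs[OF A])
  also have "\<dots> = (\<Sum>i<card A. \<Sum>as\<in>incr_seqs A i. (-1) ^ i * sum u (\<Inter>a\<in>set as. X a))"
    by (intro sum.cong refl) (auto simp: incr_seqs_def strict_sorted_iff distinct_card)
  finally show ?thesis .
qed

section \<open>Intersections of ideals and of filters\<close>

lemma hom_Inter_subcat:
  assumes "S \<noteq> {}" and full: "\<And>a. a \<in> S \<Longrightarrow> full_subcategory (D a) C"
    and x: "x \<in> Obj (Inter_subcat C S D)" and y: "y \<in> Obj (Inter_subcat C S D)"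
  shows "hom (Inter_subcat C S D) x y = hom C x y"
proof -
  have sub: "Mor (D a) \<subseteq> Mor C" if "a \<in> S" for a
    using full[OF that] by (auto simp: full_subcategory_def subcategory_def)
  have "hom (D a) x y = hom C x y" if "a \<in> S" for a
    using full[OF that] x y that by (simp add: full_subcategory_def Inter_subcat_def)
  then have "hom C x y \<subseteq> Mor (D a)" if "a \<in> S" for a
    using that by (auto simp: hom_def)
  then show ?thesis
    using \<open>S \<noteq> {}\<close> sub unfolding hom_def Inter_subcat_def by (simp, blast)
qed

lemma full_subcategory_Inter_subcat:
  assumes "category C" "S \<noteq> {}" "\<And>a. a \<in> S \<Longrightarrow> full_subcategory (D a) C"
  shows "full_subcategory (Inter_subcat C S D) C"
proof -
  have "subcategory (Inter_subcat C S D) C"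
    using assms by (intro subcategory_Inter_subcat) (auto simp: full_subcategory_def)
  then show ?thesis
    using hom_Inter_subcat[OF assms(2,3)] by (auto simp: full_subcategory_def)
qed

lemma cat_ideal_Inter_subcat:
  assumes "category C" "S \<noteq> {}" and ideal: "\<And>a. a \<in> S \<Longrightarrow> cat_ideal (D a) C"
  shows "cat_ideal (Inter_subcat C S D) C"
proof -
  have "full_subcategory (Inter_subcat C S D) C"
    using assms by (intro full_subcategory_Inter_subcat) (auto simp: cat_ideal_def)
  then show ?thesis
    using ideal unfolding cat_ideal_def by (simp add: Inter_subcat_def) blast
qed

lemma cat_filter_Inter_subcat:
  assumes "category C" "S \<noteq> {}" and "filter": "\<And>a. a \<in> S \<Longrightarrow> cat_filter (D a) C"
  shows "cat_filter (Inter_subcat C S D) C"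
proof -
  have "full_subcategory (Inter_subcat C S D) C"
    using assms by (intro full_subcategory_Inter_subcat) (auto simp: cat_filter_def)
  then show ?thesis
    using "filter" unfolding cat_filter_def by (simp add: Inter_subcat_def) blast
qed

section \<open>Restricting weightings and coweightings\<close>

text \<open>The terms of the sum over \<open>Obj C\<close> outside \<open>Obj I\<close> vanish, because no morphism enters an ideal
  from outside.\<close>

lemma coweighting_cat_ideal:
  assumes fin: "finite (Obj C)" and I: "cat_ideal I C" and v: "coweighting C v"
  shows "coweighting I v"
  unfolding coweighting_def
proof
  fix b assume b: "b \<in> Obj I"
  have sub: "Obj I \<subseteq> Obj C" and hom: "\<And>a. a \<in> Obj I \<Longrightarrow> hom I a b = hom C a b"
    using I b by (auto simp: cat_ideal_def full_subcategory_def subcategory_def)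
  have out: "hom C a b = {}" if "a \<in> Obj C - Obj I" for a
    using I b that by (auto simp: cat_ideal_def)
  have "(\<Sum>a\<in>Obj I. v a * zeta I a b) = (\<Sum>a\<in>Obj I. v a * zeta C a b)"
    by (simp add: zeta_def hom)
  also have "\<dots> = (\<Sum>a\<in>Obj C. v a * zeta C a b)"
    by (rule sum.mono_neutral_left[OF fin sub]) (simp add: zeta_def out)
  also have "\<dots> = 1"
    using v b sub by (auto simp: coweighting_def)
  finally show "(\<Sum>a\<in>Obj I. v a * zeta I a b) = 1" .
qed

text \<open>Dually, no morphism leaves a filter.\<close>

lemma weighting_cat_filter:
  assumes fin: "finite (Obj C)" and F: "cat_filter F C" and w: "weighting C w"
  shows "weighting F w"
  unfolding weighting_def
proof
  fix a assume a: "a \<in> Obj F"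
  have sub: "Obj F \<subseteq> Obj C" and hom: "\<And>b. b \<in> Obj F \<Longrightarrow> hom F a b = hom C a b"
    using F a by (auto simp: cat_filter_def full_subcategory_def subcategory_def)
  have out: "hom C a b = {}" if "b \<in> Obj C - Obj F" for b
    using F a that by (auto simp: cat_filter_def)
  have "(\<Sum>b\<in>Obj F. zeta F a b * w b) = (\<Sum>b\<in>Obj F. zeta C a b * w b)"
    by (simp add: zeta_def hom)
  also have "\<dots> = (\<Sum>b\<in>Obj C. zeta C a b * w b)"
    by (rule sum.mono_neutral_left[OF fin sub]) (simp add: zeta_def out)
  also have "\<dots> = 1"
    using w a sub by (auto simp: weighting_def)
  finally show "(\<Sum>b\<in>Obj F. zeta F a b * w b) = 1" .
qed

lemma euler_char_eq_sum_weighting: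
  assumes "has_euler_char X" "weighting X w"
  shows "euler_char X = sum w (Obj X)"
  using assms euler_char_eq(1) by (auto simp: has_euler_char_def)

lemma euler_char_eq_sum_coweighting:
  assumes "has_euler_char X" "coweighting X v"
  shows "euler_char X = sum v (Obj X)"
  using assms euler_char_eq(2) by (auto simp: has_euler_char_def)

section \<open>The Euler characteristic of a covered category\<close>

lemma Obj_cover:
  assumes "cover C A D"
  shows "Obj C = (\<Union>a\<in>A. Obj (D a))"
proof -
  have "Obj C = Obj (Union_subcat C A D)"
    using assms by (simp add: cover_def)
  then show ?thesis
    by (simp add: Union_subcat_def)
qed

theorem theorem1p2:
  fixes C :: "('o, 'm) category"
    and A :: "'i::linorder set"
    and D :: "'i \<Rightarrow> ('o, 'm) category"
  assumes "finite_category C"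
    and "finite A"
    and "ideal_cover C A D \<or> filter_cover C A D"
    and "\<And>i as. as \<in> incr_seqs A i \<Longrightarrow> has_euler_char (Inter_subcat C (set as) D)"
    and "has_euler_char C"
  shows "euler_char C =
    (\<Sum>i<card A. \<Sum>as\<in>incr_seqs A i. (-1) ^ i * euler_char (Inter_subcat C (set as) D))"
proof -
  have cat: "category C" and fin: "finite (Obj C)"
    using assms(1) by (auto simp: finite_category_def finite_category_axioms_def)
  have ne: "set as \<noteq> {}" and sub: "set as \<subseteq> A" if "as \<in> incr_seqs A i" for as i
    using that by (auto simp: incr_seqs_def)
  have "cover C A D"
    using assms(3) by (auto simp: ideal_cover_def filter_cover_def)
  note Obj_C = Obj_cover[OF this]
  \<comment> \<open>\<open>u\<close> is a coweighting of \<open>C\<close> for an ideal cover and a weighting of \<open>C\<close> for a filter cover.\<close>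
  obtain u where C: "euler_char C = sum u (Obj C)"
    and Inter: "\<And>i as. as \<in> incr_seqs A i \<Longrightarrow>
      euler_char (Inter_subcat C (set as) D) = sum u (Obj (Inter_subcat C (set as) D))"
    using assms(3)
  proof
    assume ideal: "ideal_cover C A D"
    obtain v where v: "coweighting C v"
      using assms(5) by (auto simp: has_euler_char_def)
    show thesis
    proof (rule that)
      show "euler_char C = sum v (Obj C)"
        by (rule euler_char_eq_sum_coweighting[OF assms(5) v])
      fix i as assume as: "as \<in> incr_seqs A i"
      have "cat_ideal (Inter_subcat C (set as) D) C"
        using ideal sub[OF as] by (intro cat_ideal_Inter_subcat cat ne[OF as])
          (auto simp: ideal_cover_def)
      from euler_char_eq_sum_coweighting[OF assms(4)[OF as] coweighting_cat_ideal[OF fin this v]]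
      show "euler_char (Inter_subcat C (set as) D) = sum v (Obj (Inter_subcat C (set as) D))" .
    qed
  next
    assume "filter": "filter_cover C A D"
    obtain w where w: "weighting C w"
      using assms(5) by (auto simp: has_euler_char_def)
    show thesis
    proof (rule that)
      show "euler_char C = sum w (Obj C)"
        by (rule euler_char_eq_sum_weighting[OF assms(5) w])
      fix i as assume as: "as \<in> incr_seqs A i"
      have "cat_filter (Inter_subcat C (set as) D) C"
        using "filter" sub[OF as] by (intro cat_filter_Inter_subcat cat ne[OF as])
          (auto simp: filter_cover_def)
      from euler_char_eq_sum_weighting[OF assms(4)[OF as] weighting_cat_filter[OF fin this w]]
      show "euler_char (Inter_subcat C (set as) D) = sum w (Obj (Inter_subcat C (set as) D))" .
    qed
  qed
  have "finite (Obj (D a))" if "a \<in> A" for a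
    using fin that by (auto simp: Obj_C intro: finite_subset[rotated])
  then have "sum u (Obj C) =
      (\<Sum>i<card A. \<Sum>as\<in>incr_seqs A i. (-1) ^ i * sum u (\<Inter>a\<in>set as. Obj (D a)))"
    unfolding Obj_C by (rule sum_UN_incr_seqs[OF assms(2)])
  also have "\<dots> =
      (\<Sum>i<card A. \<Sum>as\<in>incr_seqs A i. (-1) ^ i * euler_char (Inter_subcat C (set as) D))"
  proof (intro sum.cong refl)
    fix i as assume "as \<in> incr_seqs A i"
    from Inter[OF this] show "(-1) ^ i * sum u (\<Inter>a\<in>set as. Obj (D a)) =
        (-1) ^ i * euler_char (Inter_subcat C (set as) D)"
      by (simp add: Inter_subcat_def)
  qed
  finally show ?thesis
    unfolding C .
qed

end
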